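(* Let $n\geq 2$ and let $\Sigma_1,\Sigma_2,\dots,\Sigma_{n+1}$ be horospheres in $n$-dimensional hyperbolic space $H^n$. Let $A$ be the $(n+1)\times(n+1)$ matrix with entries $A_{ij}=\lambda(\Sigma_i,\Sigma_j)^2$, where $\lambda$ denotes the $\lambda$-length. Then the centres of $\Sigma_1,\Sigma_2,\dots,\Sigma_{n+1}$ lie on the ideal boundary of a common hyperplane of $H^n$ if and only if $\det A=0$.
   Context: The $\lambda$-length $\lambda(\Sigma,\Sigma')$ between two horospheres $\Sigma$ and $\Sigma'$ in $H^n$ with distinct centres is $e^{\delta/2}$, where $\delta$ is the signed hyperbolic distance between $\Sigma$ and $\Sigma'$ (measured along the geodesic joining their centres; positive if the horospheres are disjoint, zero if they are tangent, negative if they overlap). If $\Sigma$ and $\Sigma'$ have the same centre, then $\lambda(\Sigma,\Sigma')=0$. Lorentzian model: let $\mathbb{R}^{n,1}$ be $\mathbb{R}^{n+1}$ with the inner product $\langle x,y\rangle=x_1y_1+\dots+x_ny_n-x_{n+1}y_{n+1}$, and let $\|x\|^2=\langle x,x\rangle$. A vector $x$ is lightlike if $\|x\|^2=0$. Then $H^n$ is modelled by $\mathcal{H}^n=\{x\in\mathbb{R}^{n,1}:\|x\|^2=-1,\ x_{n+1}>0\}$ with distance function $\varrho$ given by $\cosh\varrho(x,y)=-\langle x,y\rangle$. The ideal boundary of $H^n$ is the set of lines of lightlike vectors. A hyperplane in $\mathcal{H}^n$ is the nonempty intersection of $\mathcal{H}^n$ with a codimension 1 subspace $W$ of $\mathbb{R}^{n,1}$;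 its ideal boundary is the set of lines of lightlike vectors contained in $W$. A horosphere in $\mathcal{H}^n$ is a (nonempty) set $\{x\in\mathcal{H}^n:\langle x,v\rangle=-1/\sqrt2\}$, where $v$ is a (nonzero) lightlike vector; the line through $v$ is the centre of the horosphere. *)

theory Defs
  imports "HOL-Analysis.Analysis"
begin

text \<open>
  Lorentzian space with \<open>n\<close> positive directions is modelled by \<^typ>\<open>(real^'n) \<times> real\<close>
  with \<open>n = CARD('n)\<close>; the second factor is the negative (time) coordinate.
\<close>

type_synonym 'n lorentz = "(real^'n) \<times> real"

definition lorentz_inner :: "'n::finite lorentz \<Rightarrow> 'n lorentz \<Rightarrow> real" where
  "lorentz_inner x y = (\<Sum>i\<in>UNIV. fst x $ i * fst y $ i) - snd x * snd y"

definition lightlike :: "'n::finite lorentz \<Rightarrow> bool" where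
  "lightlike x \<longleftrightarrow> lorentz_inner x x = 0"

definition hyp_space :: "'n::finite lorentz set" where
  "hyp_space = {x. lorentz_inner x x = -1 \<and> snd x > 0}"

definition hyp_dist :: "'n::finite lorentz \<Rightarrow> 'n lorentz \<Rightarrow> real" where
  "hyp_dist x y = arcosh (- lorentz_inner x y)"

definition ideal_boundary :: "'n::finite lorentz set set" where
  "ideal_boundary = {span {v} | v. lightlike v \<and> v \<noteq> 0}"

definition codim1_subspace :: "'n::finite lorentz set \<Rightarrow> bool" where
  "codim1_subspace W \<longleftrightarrow> subspace W \<and> dim W + 1 = DIM((real^'n) \<times> real)"

definition hyperplane :: "'n::finite lorentz set \<Rightarrow> bool" where
  "hyperplane P \<longleftrightarrow> P \<noteq> {} \<and> (\<exists>W. codim1_subspace W \<and> P = hyp_space \<inter> W)"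

text \<open>For a hyperplane \<open>P\<close> the subspace \<open>W\<close> below is unique, namely the linear span of \<open>P\<close>.\<close>

definition hyperplane_ideal_boundary :: "'n::finite lorentz set \<Rightarrow> 'n lorentz set set" where
  "hyperplane_ideal_boundary P =
     {L \<in> ideal_boundary. \<exists>W. codim1_subspace W \<and> P = hyp_space \<inter> W \<and> L \<subseteq> W}"

definition horosphere_of :: "'n::finite lorentz \<Rightarrow> 'n lorentz set" where
  "horosphere_of v = {x \<in> hyp_space. lorentz_inner x v = - 1 / sqrt 2}"

definition horosphere :: "'n::finite lorentz set \<Rightarrow> bool" where
  "horosphere S \<longleftrightarrow> S \<noteq> {} \<and> (\<exists>v. lightlike v \<and> v \<noteq> 0 \<and> S = horosphere_of v)"

text \<open>
  For \<open>CARD('n) \<ge> 2\<close> a horosphere determines its lightlike vector, so the centre is well defined.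
  (For \<open>CARD('n) = 1\<close> horospheres are single points and the centre is not determined.)
\<close>

definition centre :: "'n::finite lorentz set \<Rightarrow> 'n lorentz set" where
  "centre S = (THE L. \<exists>v. lightlike v \<and> v \<noteq> 0 \<and> S = horosphere_of v \<and> L = span {v})"

definition geodesic_joining :: "'n::finite lorentz set \<Rightarrow> 'n lorentz set \<Rightarrow> 'n lorentz set" where
  "geodesic_joining L L' = hyp_space \<inter> span (L \<union> L')"

text \<open>
  The geodesic joining the (distinct) centres of two horospheres meets each of them in exactly one
  point, and the signed distance is, up to sign, the distance between these two points. The sign is
  positive for disjoint horospheres and negative for overlapping ones; for tangent horospheres
  the two points coincide, so the second branch is 0. Horospheres with distinct centres are
  disjoint as sets iff the horoballs they bound are disjoint.
\<close>

definition signed_dist :: "'n::finite lorentz set \<Rightarrow> 'n lorentz set \<Rightarrow> real" where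
  "signed_dist S S' =
     (let g = geodesic_joining (centre S) (centre S');
          d = hyp_dist (the_elem (S \<inter> g)) (the_elem (S' \<inter> g))
      in if S \<inter> S' = {} then d else - d)"

definition lambda_length :: "'n::finite lorentz set \<Rightarrow> 'n lorentz set \<Rightarrow> real" where
  "lambda_length S S' =
     (if centre S = centre S' then 0 else exp (signed_dist S S' / 2))"

end

theory Submission
  imports Defs
begin

text \<open>
  A horosphere is a level set of the Lorentzian product with a lightlike vector \<open>v\<close>, and since it
  is nonempty, \<open>v\<close> lies on the future half of the light cone. In these terms the squared
  \<open>\<lambda>\<close>-length is linear algebra: for two horospheres with vectors \<open>v\<close> and \<open>w\<close> it equals the
  negated Lorentzian product of \<open>v\<close> and \<open>w\<close> (lemma \<open>lambda_length_squared\<close>). Indeed, if this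
  number is \<open>c > 0\<close>, the geodesic between the centres spans the plane of \<open>v\<close> and \<open>w\<close>, its two
  intersection points are explicit combinations of \<open>v\<close> and \<open>w\<close> at distance \<open>\<bar>ln c\<bar>\<close>, and the
  horospheres are disjoint exactly when \<open>c > 1\<close>, so that the signed distance is \<open>ln c\<close>. If
  \<open>c = 0\<close>, the two vectors are parallel, the centres agree and both sides are \<open>0\<close>.

  The matrix \<open>A\<close> is therefore the negated Gram matrix of \<open>n + 1\<close> vectors \<open>v i\<close> in the
  \<open>(n + 1)\<close>-dimensional space. As the Lorentzian form is nondegenerate, \<open>det A = 0\<close> means that
  the \<open>v i\<close> are linearly dependent (lemma \<open>det_lorentz_gram_eq_0_iff\<close>), that is, that they lie
  in some subspace of codimension one.

  Such a subspace need not give a hyperplane of hyperbolic space, because it may miss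
  \<open>hyp_space\<close>. This is where lemma \<open>common_hyperplane_iff\<close> needs an argument: if two of the \<open>v i\<close>
  are not parallel, their sum is timelike, so every subspace containing all \<open>v i\<close> meets
  \<open>hyp_space\<close>; if all of them are parallel, the subspace can be chosen to contain a timelike
  vector as well, since \<open>n \<ge> 2\<close>.
\<close>

section \<open>The Lorentzian form\<close>

lemma lorentz_inner_eq:
  "lorentz_inner x y = inner (fst x) (fst y) - snd x * snd y"
  by (simp add: lorentz_inner_def inner_vec_def)

lemma lorentz_inner_commute: "lorentz_inner x y = lorentz_inner y x"
  by (simp add: lorentz_inner_eq inner_commute)

lemma lorentz_inner_simps [simp]:
  "lorentz_inner (x + y) z = lorentz_inner x z + lorentz_inner y z"
  "lorentz_inner z (x + y) = lorentz_inner z x + lorentz_inner z y"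
  "lorentz_inner (x - y) z = lorentz_inner x z - lorentz_inner y z"
  "lorentz_inner z (x - y) = lorentz_inner z x - lorentz_inner z y"
  "lorentz_inner (c *\<^sub>R x) z = c * lorentz_inner x z"
  "lorentz_inner z (c *\<^sub>R x) = c * lorentz_inner z x"
  "lorentz_inner 0 z = 0"
  "lorentz_inner z 0 = 0"
  by (simp_all add: lorentz_inner_eq inner_simps algebra_simps)

lemma lorentz_inner_sum_right: "lorentz_inner z (sum f I) = (\<Sum>i\<in>I. lorentz_inner z (f i))"
  by (induction I rule: infinite_finite_induct) simp_all

text \<open>
  Reflecting the time coordinate turns the Lorentzian product into the Euclidean one. Lorentzian
  orthogonality becomes Euclidean orthogonality, so that results on Euclidean hyperplanes and
  dimensions apply.
\<close>

definition time_reflect :: "'n::finite lorentz \<Rightarrow> 'n lorentz" where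
  "time_reflect x = (fst x, - snd x)"

lemma lorentz_inner_eq_inner: "lorentz_inner x y = inner (time_reflect x) y"
  by (simp add: lorentz_inner_eq time_reflect_def inner_prod_def)

lemma time_reflect_time_reflect [simp]: "time_reflect (time_reflect x) = x"
  by (simp add: time_reflect_def)

lemma time_reflect_eq_0_iff [simp]: "time_reflect x = 0 \<longleftrightarrow> x = 0"
  by (simp add: time_reflect_def prod_eq_iff)

lemma space_le_time_if_causal:
  assumes "lorentz_inner x x \<le> 0" shows "norm (fst x) \<le> \<bar>snd x\<bar>"
proof -
  have "(norm (fst x))\<^sup>2 \<le> \<bar>snd x\<bar>\<^sup>2"
    using assms by (simp add: lorentz_inner_eq dot_square_norm power2_eq_square)
  then show ?thesis by (rule power2_le_imp_le) simp
qed

lemma space_less_time_if_timelike: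
  assumes "lorentz_inner x x < 0" shows "norm (fst x) < \<bar>snd x\<bar>"
proof -
  have "(norm (fst x))\<^sup>2 < \<bar>snd x\<bar>\<^sup>2"
    using assms by (simp add: lorentz_inner_eq dot_square_norm power2_eq_square)
  then show ?thesis by (rule power2_less_imp_less) simp
qed

text \<open>
  Whether a timelike and a causal vector point to the same half of the light cone can be read off
  their product: by the Cauchy-Schwarz inequality the spatial part is dominated strictly by the
  time part, so the latter determines the sign.
\<close>

lemma lorentz_inner_neg_iff:
  assumes x: "lorentz_inner x x < 0" and y: "lorentz_inner y y \<le> 0" and "y \<noteq> 0"
  shows "lorentz_inner x y < 0 \<longleftrightarrow> snd x * snd y > 0"
proof -
  have nx: "norm (fst x) < \<bar>snd x\<bar>" and ny: "norm (fst y) \<le> \<bar>snd y\<bar>"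
    using x y by (auto intro: space_le_time_if_causal space_less_time_if_timelike)
  have y0: "snd y \<noteq> 0"
    using ny \<open>y \<noteq> 0\<close> by (auto simp: prod_eq_iff)
  have "\<bar>inner (fst x) (fst y)\<bar> \<le> norm (fst x) * norm (fst y)"
    by (rule Cauchy_Schwarz_ineq2)
  also have "\<dots> \<le> norm (fst x) * \<bar>snd y\<bar>"
    by (intro mult_left_mono ny) simp
  also have "\<dots> < \<bar>snd x\<bar> * \<bar>snd y\<bar>"
    using nx y0 by (intro mult_strict_right_mono) auto
  finally have "\<bar>inner (fst x) (fst y)\<bar> < \<bar>snd x * snd y\<bar>"
    by (simp add: abs_mult)
  then show ?thesis by (auto simp: lorentz_inner_eq abs_if split: if_splits)
qed

text \<open>
  Otherwise \<open>u\<close> or \<open>-u\<close> would be a causal vector on the same side as \<open>x\<close>, and its product with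
  \<open>x\<close> would be negative.
\<close>

lemma spacelike_if_orthogonal_timelike:
  assumes x: "lorentz_inner x x < 0" and "lorentz_inner x u = 0" and "u \<noteq> 0"
  shows "lorentz_inner u u > 0"
proof (rule ccontr)
  assume "\<not> ?thesis"
  then have u: "lorentz_inner u u \<le> 0" by simp
  then have u': "lorentz_inner (-1 *\<^sub>R u) (-1 *\<^sub>R u) \<le> 0"
    by (simp only: lorentz_inner_simps)
  have "snd u \<noteq> 0" using space_le_time_if_causal[OF u] \<open>u \<noteq> 0\<close> by (auto simp: prod_eq_iff)
  moreover have "snd x \<noteq> 0" using space_less_time_if_timelike[OF x] by auto
  ultimately have "snd x * snd u > 0 \<or> snd x * snd (-1 *\<^sub>R u) > 0"
    by (auto simp: zero_less_mult_iff mult_less_0_iff neq_iff)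
  then have "lorentz_inner x u < 0 \<or> lorentz_inner x (-1 *\<^sub>R u) < 0"
    using lorentz_inner_neg_iff[OF x u] lorentz_inner_neg_iff[OF x u'] \<open>u \<noteq> 0\<close> by auto
  then show False using assms(2) by (simp only: lorentz_inner_simps) auto
qed

definition future_lightlike :: "'n::finite lorentz \<Rightarrow> bool" where
  "future_lightlike v \<longleftrightarrow> lightlike v \<and> snd v > 0"

lemma future_lightlike_nonzero: "future_lightlike v \<Longrightarrow> v \<noteq> 0"
  by (auto simp: future_lightlike_def)

lemma future_lightlike_self: "future_lightlike v \<Longrightarrow> lorentz_inner v v = 0"
  by (simp add: future_lightlike_def lightlike_def)

lemma norm_fst_future_lightlike:
  assumes "future_lightlike v" shows "norm (fst v) = snd v"
proof -
  have "(norm (fst v))\<^sup>2 = (snd v)\<^sup>2"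
    using assms by (simp add: future_lightlike_def lightlike_def lorentz_inner_eq
        dot_square_norm power2_eq_square)
  then show ?thesis using assms by (simp add: power2_eq_iff_nonneg future_lightlike_def)
qed

lemma lorentz_inner_future_nonpos:
  assumes "future_lightlike v" "future_lightlike w"
  shows "lorentz_inner v w \<le> 0"
  using norm_cauchy_schwarz[of "fst v" "fst w"] assms
  by (simp add: lorentz_inner_eq norm_fst_future_lightlike)

text \<open>
  For lightlike vectors, orthogonality is the equality case of the Cauchy-Schwarz inequality for
  the spatial parts.
\<close>

lemma orthogonal_future_lightlike_parallel:
  assumes v: "future_lightlike v" and w: "future_lightlike w" and "lorentz_inner v w = 0"
  shows "snd v *\<^sub>R w = snd w *\<^sub>R v"
proof -
  have "inner (fst v) (fst w) = norm (fst v) * norm (fst w)"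
    using assms by (simp add: lorentz_inner_eq norm_fst_future_lightlike)
  then have "norm (fst v) *\<^sub>R fst w = norm (fst w) *\<^sub>R fst v"
    by (simp add: norm_cauchy_schwarz_eq)
  then show ?thesis
    using v w by (simp add: prod_eq_iff norm_fst_future_lightlike)
qed

lemma span_eq_iff_orthogonal:
  assumes v: "future_lightlike v" and w: "future_lightlike w"
  shows "span {v} = span {w} \<longleftrightarrow> lorentz_inner v w = 0"
proof
  assume "span {v} = span {w}"
  then have "v \<in> span {w}" using span_base[of v "{v}"] by simp
  then obtain k where "v = k *\<^sub>R w" by (auto simp: span_singleton)
  then show "lorentz_inner v w = 0" using future_lightlike_self[OF w] by simp
next
  assume "lorentz_inner v w = 0"
  then have *: "snd v *\<^sub>R w = snd w *\<^sub>R v"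
    using v w by (rule orthogonal_future_lightlike_parallel[rotated 2])
  have pos: "snd v \<noteq> 0" "snd w \<noteq> 0" using v w by (auto simp: future_lightlike_def)
  have "span {v} = span {snd w *\<^sub>R v}" "span {w} = span {snd v *\<^sub>R w}"
    using pos span_image_scale[of "{v}" "\<lambda>_. snd w"] span_image_scale[of "{w}" "\<lambda>_. snd v"]
    by simp_all
  then show "span {v} = span {w}" using * by simp
qed

text \<open>
  Two vectors span a proper subspace because the dimension of the whole space is at least three.
  This is how \<open>n \<ge> 2\<close> enters the geometry of horospheres.
\<close>

lemma exists_lorentz_orthogonal:
  fixes x y :: "'n::finite lorentz"
  assumes "CARD('n) \<ge> 2"
  obtains u where "u \<noteq> 0" "lorentz_inner x u = 0" "lorentz_inner y u = 0"
proof -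
  have "dim {x, y} \<le> card {x, y}" by (rule dim_le_card') simp
  also have "\<dots> \<le> 2" by (simp add: card_insert_if)
  also have "\<dots> < DIM('n lorentz)" using assms by simp
  finally obtain a where a: "a \<noteq> 0" "span {x, y} \<subseteq> {z. inner a z = 0}"
    using lowdim_subset_hyperplane by metis
  have "inner a x = 0" "inner a y = 0"
    using a(2) span_base[of x "{x,y}"] span_base[of y "{x,y}"] by auto
  moreover have "lorentz_inner z (time_reflect a) = inner a z" for z
    by (metis lorentz_inner_commute lorentz_inner_eq_inner time_reflect_time_reflect)
  ultimately show ?thesis
    using a(1) by (intro that[of "time_reflect a"]) simp_all
qed

section \<open>Horospheres and their centres\<close>

text \<open>
  The product with a future vector is already negative, which forces the positive time coordinate
  demanded by \<open>hyp_space\<close>.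
\<close>

lemma mem_horosphere_of_iff:
  assumes "future_lightlike v"
  shows "x \<in> horosphere_of v \<longleftrightarrow> lorentz_inner x x = -1 \<and> lorentz_inner x v = - 1 / sqrt 2"
proof -
  have "snd x > 0" if "lorentz_inner x x = -1" "lorentz_inner x v = - 1 / sqrt 2"
  proof -
    have "lorentz_inner x v < 0" using that by simp
    then have "snd x * snd v > 0"
      using lorentz_inner_neg_iff[of x v] that assms future_lightlike_nonzero[OF assms]
      by (auto simp: future_lightlike_self)
    then show ?thesis using assms by (auto simp: future_lightlike_def zero_less_mult_iff)
  qed
  then show ?thesis by (auto simp: horosphere_of_def hyp_space_def)
qed

lemma future_lightlike_if_horosphere_nonempty:
  assumes "lightlike v" "v \<noteq> 0" "horosphere_of v \<noteq> {}"
  shows "future_lightlike v"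
proof -
  obtain x where x: "lorentz_inner x x = -1" "snd x > 0" "lorentz_inner x v = - 1 / sqrt 2"
    using assms(3) by (auto simp: horosphere_of_def hyp_space_def)
  then have "lorentz_inner x v < 0" by simp
  then have "snd x * snd v > 0"
    using lorentz_inner_neg_iff[of x v] x assms by (auto simp: lightlike_def)
  then show ?thesis using x assms by (auto simp: future_lightlike_def zero_less_mult_iff)
qed

text \<open>
  Horospheres have well-defined centres. From a point \<open>p\<close> of the horosphere, move in a spacelike
  direction \<open>u\<close> orthogonal to \<open>p\<close> and \<open>v\<close>, in both senses, and correct by the same multiple
  \<open>t\<close> of \<open>v\<close> to stay on the horosphere. If the product with \<open>w\<close> is constant there as well, then
  adding the two conditions cancels \<open>u\<close> and leaves \<open>v\<close> orthogonal to \<open>w\<close>.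
\<close>

lemma horosphere_of_inject_span:
  fixes v w :: "'n::finite lorentz"
  assumes n: "CARD('n) \<ge> 2" and v: "future_lightlike v" and w: "future_lightlike w"
    and ne: "horosphere_of v \<noteq> {}" and eq: "horosphere_of v = horosphere_of w"
  shows "span {v} = span {w}"
proof -
  obtain p where p: "p \<in> horosphere_of v" using ne by auto
  have pp: "lorentz_inner p p = -1" and pv: "lorentz_inner p v = - 1 / sqrt 2"
    using p v by (auto simp: mem_horosphere_of_iff)
  have pw: "lorentz_inner p w = - 1 / sqrt 2"
    using p w eq by (auto simp: mem_horosphere_of_iff)
  obtain u where u: "u \<noteq> 0" "lorentz_inner p u = 0" "lorentz_inner v u = 0"
    using exists_lorentz_orthogonal[OF n] by metis
  have uu: "lorentz_inner u u > 0"
    using spacelike_if_orthogonal_timelike[of p u] pp u by simp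
  \<comment> \<open>\<open>t\<close> is fixed by the requirement that \<open>p \<plusminus> u + t v\<close> has Lorentzian square \<open>-1\<close>.\<close>
  define t where "t = lorentz_inner u u / sqrt 2"
  have on: "lorentz_inner (p + s *\<^sub>R u + t *\<^sub>R v) w = - 1 / sqrt 2" if "s\<^sup>2 = 1" for s
  proof -
    have "sqrt 2 * t = lorentz_inner u u" by (simp add: t_def)
    moreover have "2 * t / sqrt 2 = sqrt 2 * t"
      by (simp add: real_div_sqrt flip: times_divide_eq_left)
    moreover have "s * (s * lorentz_inner u u) = lorentz_inner u u"
      using that by (metis mult.assoc mult_1 power2_eq_square)
    ultimately have "p + s *\<^sub>R u + t *\<^sub>R v \<in> horosphere_of v"
      using pp pv u v unfolding mem_horosphere_of_iff[OF v]
      by (simp add: future_lightlike_self lorentz_inner_commute[of u p]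
          lorentz_inner_commute[of v p] lorentz_inner_commute[of u v])
    then show ?thesis using eq w by (simp only: mem_horosphere_of_iff)
  qed
  have "t * lorentz_inner v w = 0"
    using on[of 1] on[of "-1"] pw by simp
  then have "lorentz_inner v w = 0" using uu by (simp add: t_def)
  then show ?thesis using v w by (simp add: span_eq_iff_orthogonal)
qed

lemma centre_horosphere_of:
  fixes v :: "'n::finite lorentz"
  assumes n: "CARD('n) \<ge> 2" and v: "future_lightlike v" and ne: "horosphere_of v \<noteq> {}"
  shows "centre (horosphere_of v) = span {v}"
  unfolding centre_def
proof (rule the_equality)
  show "\<exists>w. lightlike w \<and> w \<noteq> 0 \<and> horosphere_of v = horosphere_of w \<and> span {v} = span {w}"
    using v future_lightlike_nonzero[OF v] unfolding future_lightlike_def by blast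
next
  fix L assume "\<exists>w. lightlike w \<and> w \<noteq> 0 \<and> horosphere_of v = horosphere_of w \<and> L = span {w}"
  then show "L = span {v}"
    using horosphere_of_inject_span[OF n v] future_lightlike_if_horosphere_nonempty ne by metis
qed

section \<open>The \<open>\<lambda>\<close>-length as a Lorentzian product\<close>

lemma span_two_lines:
  "x \<in> span (span {v} \<union> span {w}) \<longleftrightarrow> (\<exists>a b. x = a *\<^sub>R v + b *\<^sub>R (w::'a::real_vector))"
proof -
  have "span (span {v} \<union> span {w}) = {a + b |a b. a \<in> span {v} \<and> b \<in> span {w}}"
    by (simp add: span_Un span_span)
  then show ?thesis by (auto simp: span_singleton)
qed

text \<open>
  A point of the geodesic is \<open>a v + b w\<close>. The equation of the horosphere determines \<open>b\<close>, and
  then the square \<open>-1\<close> determines \<open>a\<close>.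
\<close>

lemma horosphere_meets_geodesic:
  fixes v w :: "'n::finite lorentz"
  assumes v: "future_lightlike v" and w: "future_lightlike w"
    and c: "lorentz_inner v w = - c" "c > 0"
  shows "horosphere_of v \<inter> geodesic_joining (span {v}) (span {w})
       = {(1 / sqrt 2) *\<^sub>R v + (1 / (c * sqrt 2)) *\<^sub>R w}" (is "_ = {?p}")
proof -
  have vw: "lorentz_inner v v = 0" "lorentz_inner w w = 0" "lorentz_inner w v = - c"
    using v w c by (simp_all add: future_lightlike_self lorentz_inner_commute[of w v])
  have "?p \<in> horosphere_of v"
    using c vw by (simp add: mem_horosphere_of_iff[OF v])
  moreover have "?p \<in> geodesic_joining (span {v}) (span {w})"
    using calculation unfolding geodesic_joining_def Int_iff span_two_lines
    by (auto simp: horosphere_of_def)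
  moreover have "x = ?p"
    if x: "x \<in> horosphere_of v" and g: "x \<in> geodesic_joining (span {v}) (span {w})" for x
  proof -
    obtain a b where ab: "x = a *\<^sub>R v + b *\<^sub>R w"
      using g by (auto simp: geodesic_joining_def span_two_lines)
    have xv: "lorentz_inner x v = - 1 / sqrt 2" and xx: "lorentz_inner x x = -1"
      using x by (simp_all add: mem_horosphere_of_iff[OF v])
    have 1: "b * c = 1 / sqrt 2" using xv vw by (simp add: ab)
    have 2: "2 * a * (b * c) = 1" using xx vw c by (simp add: ab algebra_simps)
    have b: "b = 1 / (c * sqrt 2)" using 1 c by (simp add: field_simps)
    have "a * (2 / sqrt 2) = 1" using 2 unfolding 1 by auto
    then have "a * sqrt 2 = 1" by (simp add: real_div_sqrt)
    then have a: "a = 1 / sqrt 2" by (simp add: eq_divide_eq)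
    show ?thesis unfolding ab a b ..
  qed
  ultimately show ?thesis by blast
qed

text \<open>
  Every common point of the two level sets is \<open>m + u\<close>, where \<open>m\<close> is a timelike combination of
  \<open>v\<close> and \<open>w\<close> of square \<open>-1 / c\<close>, and \<open>u\<close> is orthogonal to both and hence spacelike or zero. For
  the square to be \<open>-1\<close>, that of \<open>u\<close> must be \<open>1 / c - 1\<close>, which is possible only for \<open>c \<le> 1\<close>;
  conversely, a nonzero orthogonal direction exists and can be scaled to the required length.
\<close>

lemma horospheres_disjoint_iff:
  fixes v w :: "'n::finite lorentz"
  assumes n: "CARD('n) \<ge> 2" and v: "future_lightlike v" and w: "future_lightlike w"
    and c: "lorentz_inner v w = - c" "c > 0"
  shows "horosphere_of v \<inter> horosphere_of w = {} \<longleftrightarrow> c > 1"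
proof -
  have vw: "lorentz_inner v v = 0" "lorentz_inner w w = 0" "lorentz_inner w v = - c"
    using v w c by (simp_all add: future_lightlike_self lorentz_inner_commute[of w v])
  define m where "m = (1 / (c * sqrt 2)) *\<^sub>R (v + w)"
  have m: "lorentz_inner m v = - 1 / sqrt 2" "lorentz_inner m w = - 1 / sqrt 2"
    "lorentz_inner m m = - 1 / c"
    using vw c by (simp_all add: m_def field_simps)
  have mneg: "lorentz_inner m m < 0" using m c by simp
  have "c \<le> 1" if x: "x \<in> horosphere_of v" "x \<in> horosphere_of w" for x
  proof -
    have xs: "lorentz_inner x x = -1" "lorentz_inner x v = - 1 / sqrt 2" "lorentz_inner x w = - 1 / sqrt 2"
      using x v w by (simp_all add: mem_horosphere_of_iff)
    have xm: "lorentz_inner x m = - 1 / c" using xs c by (simp add: m_def field_simps)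
    have "lorentz_inner m (x - m) = 0"
      using xm m by (simp add: lorentz_inner_commute[of m x])
    then have "lorentz_inner (x - m) (x - m) \<ge> 0"
      using spacelike_if_orthogonal_timelike[OF mneg, of "x - m"] by (cases "x - m = 0") auto
    then have "1 / c \<ge> 1" using xs xm m by (simp add: lorentz_inner_commute[of m x])
    then show ?thesis using c by (simp add: field_simps)
  qed
  moreover have "horosphere_of v \<inter> horosphere_of w \<noteq> {}" if "c \<le> 1"
  proof -
    obtain u where u: "u \<noteq> 0" "lorentz_inner v u = 0" "lorentz_inner w u = 0"
      using exists_lorentz_orthogonal[OF n] by metis
    have um: "lorentz_inner m u = 0" using u by (simp add: m_def)
    have uu: "lorentz_inner u u > 0"
      using spacelike_if_orthogonal_timelike[OF mneg um] u by simp
    define s where "s = sqrt ((1 / c - 1) / lorentz_inner u u)"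
    have "s * s = (1 / c - 1) / lorentz_inner u u"
      using that c uu by (simp add: s_def field_simps)
    then have ss: "s * (s * lorentz_inner u u) = 1 / c - 1"
      using uu by (simp add: field_simps)
    have "m + s *\<^sub>R u \<in> horosphere_of v \<inter> horosphere_of w"
      using m u um ss by (simp add: mem_horosphere_of_iff[OF v] mem_horosphere_of_iff[OF w]
          lorentz_inner_commute[of u m] lorentz_inner_commute[of u v]
          lorentz_inner_commute[of u w])
    then show ?thesis by blast
  qed
  ultimately show ?thesis by force
qed

lemma arcosh_mean_inverse:
  assumes "c > (0::real)" shows "arcosh ((c + inverse c) / 2) = \<bar>ln c\<bar>"
proof -
  have "(c + inverse c) / 2 = cosh \<bar>ln c\<bar>" using assms by (simp add: cosh_ln_real)
  then show ?thesis by (simp only: arcosh_cosh_real abs_ge_zero)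
qed

text \<open>
  For distinct centres, the two points on the geodesic have product \<open>-(c + 1 / c) / 2 = - cosh (ln c)\<close>, where
  \<open>c\<close> is the negated product of \<open>v\<close> and \<open>w\<close>, so their distance is \<open>\<bar>ln c\<bar>\<close>. The sign rule
  for \<open>signed_dist\<close> removes the absolute value, since disjointness is the condition \<open>c > 1\<close>.
\<close>

lemma lambda_length_squared:
  fixes v w :: "'n::finite lorentz"
  assumes n: "CARD('n) \<ge> 2" and v: "future_lightlike v" and w: "future_lightlike w"
    and nev: "horosphere_of v \<noteq> {}" and new: "horosphere_of w \<noteq> {}"
  shows "(lambda_length (horosphere_of v) (horosphere_of w))\<^sup>2 = - lorentz_inner v w"
proof (cases "lorentz_inner v w = 0")
  case True
  then show ?thesis
    using assms by (simp add: lambda_length_def centre_horosphere_of span_eq_iff_orthogonal)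
next
  case False
  define c where "c = - lorentz_inner v w"
  have c: "lorentz_inner v w = - c" "c > 0" "lorentz_inner w v = - c"
    using False lorentz_inner_future_nonpos[OF v w]
    by (auto simp: c_def lorentz_inner_commute[of w v])
  let ?p = "(1 / sqrt 2) *\<^sub>R v + (1 / (c * sqrt 2)) *\<^sub>R w"
  let ?q = "(1 / sqrt 2) *\<^sub>R w + (1 / (c * sqrt 2)) *\<^sub>R v"
  have p: "horosphere_of v \<inter> geodesic_joining (span {v}) (span {w}) = {?p}"
    by (rule horosphere_meets_geodesic[OF v w c(1,2)])
  have q: "horosphere_of w \<inter> geodesic_joining (span {v}) (span {w}) = {?q}"
    using horosphere_meets_geodesic[OF w v c(3,2)] by (simp add: geodesic_joining_def Un_commute)
  have "- lorentz_inner ?p ?q = (c + inverse c) / 2"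
    using v w c by (simp add: future_lightlike_self field_simps)
  then have "hyp_dist ?p ?q = \<bar>ln c\<bar>"
    using c by (simp only: hyp_dist_def arcosh_mean_inverse)
  then have "signed_dist (horosphere_of v) (horosphere_of w) = ln c"
    using horospheres_disjoint_iff[OF n v w c(1,2)] c(2) assms
    by (auto simp: signed_dist_def Let_def centre_horosphere_of p q)
  then have "lambda_length (horosphere_of v) (horosphere_of w) = exp (ln c / 2)"
    using False assms by (simp add: lambda_length_def centre_horosphere_of span_eq_iff_orthogonal)
  then have "(lambda_length (horosphere_of v) (horosphere_of w))\<^sup>2 = exp (ln c)"
    by (simp add: power2_eq_square flip: exp_add)
  then show ?thesis using c by simp
qed

section \<open>Hyperplanes\<close>

lemma in_subspace_scale_iff:
  assumes "subspace W" "c \<noteq> (0::real)"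
  shows "c *\<^sub>R x \<in> W \<longleftrightarrow> x \<in> W"
proof
  assume "c *\<^sub>R x \<in> W"
  then have "inverse c *\<^sub>R c *\<^sub>R x \<in> W" by (rule subspace_scale[OF assms(1)])
  then show "x \<in> W" using assms(2) by simp
qed (rule subspace_scale[OF assms(1)])

lemma codim1_subspace_hyperplane:
  fixes a :: "'n::finite lorentz"
  assumes "a \<noteq> 0" shows "codim1_subspace {x. inner a x = 0}"
  using assms by (simp add: codim1_subspace_def subspace_hyperplane dim_hyperplane)

lemma timelike_scaled_in_hyp_space:
  assumes "lorentz_inner x x < 0" "snd x > 0"
  shows "(1 / sqrt (- lorentz_inner x x)) *\<^sub>R x \<in> hyp_space"
  using assms by (simp add: hyp_space_def field_simps)

text \<open>
  A hyperplane determines its linear subspace: the timelike cone is open, so for a point \<open>p\<close> of the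
  hyperplane and any \<open>x\<close> in the subspace, \<open>p + e x\<close> with small \<open>e\<close> is a multiple of a point
  of the hyperplane. This is needed because the subspace in \<open>hyperplane_ideal_boundary\<close> may, a
  priori, vary with the ideal point.
\<close>

lemma span_hyp_space_Int:
  assumes W: "subspace W" and ne: "hyp_space \<inter> W \<noteq> {}"
  shows "span (hyp_space \<inter> W) = W"
proof
  show "span (hyp_space \<inter> W) \<subseteq> W" using W by (simp add: span_minimal)
next
  obtain p where p: "p \<in> hyp_space" "p \<in> W" using ne by auto
  show "W \<subseteq> span (hyp_space \<inter> W)"
  proof
    fix x assume x: "x \<in> W"
    let ?y = "\<lambda>e. p + e *\<^sub>R x"
    have "((\<lambda>e. lorentz_inner (?y e) (?y e)) \<longlongrightarrow> lorentz_inner (?y 0) (?y 0)) (at_right 0)"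
      by (simp only: lorentz_inner_eq fst_add snd_add fst_scaleR snd_scaleR)
         (intro tendsto_intros)
    moreover have "lorentz_inner (?y 0) (?y 0) < 0" using p by (simp add: hyp_space_def)
    ultimately have 1: "\<forall>\<^sub>F e in at_right 0. lorentz_inner (?y e) (?y e) < 0"
      by (rule order_tendstoD)
    have "((\<lambda>e. snd (?y e)) \<longlongrightarrow> snd (?y 0)) (at_right 0)" by (intro tendsto_intros)
    moreover have "snd (?y 0) > 0" using p by (simp add: hyp_space_def)
    ultimately have 2: "\<forall>\<^sub>F e in at_right 0. snd (?y e) > 0" by (rule order_tendstoD)
    have "\<forall>\<^sub>F e in at_right (0::real). e > 0" by (rule eventually_at_right_less)
    with 1 2 have "\<forall>\<^sub>F e in at_right 0. e > 0 \<and> snd (?y e) > 0 \<and> lorentz_inner (?y e) (?y e) < 0"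
      by eventually_elim blast
    then obtain e where e: "e > 0" "snd (?y e) > 0" "lorentz_inner (?y e) (?y e) < 0"
      using eventually_happens by (metis (mono_tags, lifting) trivial_limit_at_right_real)
    define k where "k = 1 / sqrt (- lorentz_inner (?y e) (?y e))"
    have k: "k \<noteq> 0" using e by (simp add: k_def)
    have "k *\<^sub>R ?y e \<in> hyp_space"
      unfolding k_def by (rule timelike_scaled_in_hyp_space[OF e(3,2)])
    moreover have "k *\<^sub>R ?y e \<in> W"
      using W p x by (intro subspace_scale subspace_add)
    ultimately have "k *\<^sub>R ?y e \<in> span (hyp_space \<inter> W)" by (simp add: span_base)
    then have "?y e \<in> span (hyp_space \<inter> W)"
      using k by (simp only: in_subspace_scale_iff[OF subspace_span] not_False_eq_True)
    moreover have "p \<in> span (hyp_space \<inter> W)" using p by (simp add: span_base)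
    ultimately have "?y e - p \<in> span (hyp_space \<inter> W)" by (rule span_diff)
    then have "e *\<^sub>R x \<in> span (hyp_space \<inter> W)" by simp
    then show "x \<in> span (hyp_space \<inter> W)" using e(1) by (simp add: in_subspace_scale_iff[OF subspace_span])
  qed
qed

lemma hyperplane_through_vectors:
  fixes B :: "'n::finite lorentz set"
  assumes "dim B < DIM('n lorentz)" and p: "p \<in> span B" "p \<in> hyp_space"
  obtains W where "codim1_subspace W" "hyp_space \<inter> W \<noteq> {}" "B \<subseteq> W"
proof -
  obtain a where a: "a \<noteq> 0" "span B \<subseteq> {x. inner a x = 0}"
    using lowdim_subset_hyperplane[OF assms(1)] by metis
  show ?thesis
    using a p span_superset[of B]
    by (intro that[of "{x. inner a x = 0}"] codim1_subspace_hyperplane) auto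
qed

text \<open>
  Any subspace of codimension one through the \<open>v i\<close> would do if it met \<open>hyp_space\<close>. The proof
  of the nontrivial direction therefore first exhibits a point \<open>p\<close> of \<open>hyp_space\<close> that can be
  included without exhausting the dimension.
\<close>

lemma common_hyperplane_iff:
  fixes v :: "'m::finite \<Rightarrow> 'n::finite lorentz"
  assumes n: "CARD('n) \<ge> 2" and v: "\<And>i. future_lightlike (v i)"
  shows "(\<exists>P. hyperplane P \<and> (\<forall>i. span {v i} \<in> hyperplane_ideal_boundary P))
    \<longleftrightarrow> dim (range v) < DIM('n lorentz)"
proof
  assume "\<exists>P. hyperplane P \<and> (\<forall>i. span {v i} \<in> hyperplane_ideal_boundary P)"
  then obtain P where P: "hyperplane P" and vP: "\<And>i. span {v i} \<in> hyperplane_ideal_boundary P"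
    by blast
  obtain W where W: "codim1_subspace W" "P = hyp_space \<inter> W" and ne: "hyp_space \<inter> W \<noteq> {}"
    using P by (auto simp: hyperplane_def)
  have "v i \<in> W" for i
  proof -
    obtain W' where W': "codim1_subspace W'" "P = hyp_space \<inter> W'" "span {v i} \<subseteq> W'"
      using vP[of i] by (auto simp: hyperplane_ideal_boundary_def)
    have "W' = span P" "W = span P"
      using W W' ne span_hyp_space_Int[of W] span_hyp_space_Int[of W']
      by (auto simp: codim1_subspace_def)
    then show ?thesis using W'(3) span_base[of "v i" "{v i}"] by auto
  qed
  then have "dim (range v) \<le> dim W" by (intro dim_subset) auto
  then show "dim (range v) < DIM('n lorentz)" using W(1) by (simp add: codim1_subspace_def)
next
  assume dim: "dim (range v) < DIM('n lorentz)"
  have "\<exists>B p. dim B < DIM('n lorentz) \<and> p \<in> span B \<and> p \<in> hyp_space \<and> range v \<subseteq> span B"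
  proof (cases "\<exists>i j. lorentz_inner (v i) (v j) \<noteq> 0")
    case True
    then obtain i j where ij: "lorentz_inner (v i) (v j) \<noteq> 0" by blast
    then have "lorentz_inner (v i) (v j) < 0"
      using lorentz_inner_future_nonpos[OF v v, of i j] by simp
    then have neg: "lorentz_inner (v i + v j) (v i + v j) < 0"
      using v by (simp add: future_lightlike_self lorentz_inner_commute[of "v j" "v i"])
    have "snd (v i + v j) > 0" using v[of i] v[of j] by (simp add: future_lightlike_def)
    note timelike_scaled_in_hyp_space[OF neg this]
    moreover have "(1 / sqrt (- lorentz_inner (v i + v j) (v i + v j))) *\<^sub>R (v i + v j) \<in> span (range v)"
      by (intro span_scale span_add span_base) auto
    ultimately show ?thesis using dim span_superset[of "range v"] by blast
  next
    case False
    \<comment> \<open>All \<open>v i\<close> are parallel to one of them, so a plane containing it and the time axis suffices.\<close>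
    fix i0 :: 'm
    let ?p = "(0, 1) :: 'n lorentz"
    let ?B = "{v i0, ?p}"
    have "dim ?B \<le> card ?B" by (rule dim_le_card') simp
    also have "\<dots> \<le> 2" by (simp add: card_insert_if)
    also have "\<dots> < DIM('n lorentz)" using n by simp
    finally have "dim ?B < DIM('n lorentz)" .
    moreover have "?p \<in> span ?B" by (simp add: span_base)
    moreover have "?p \<in> hyp_space" by (simp add: hyp_space_def lorentz_inner_eq)
    moreover have "v i \<in> span ?B" for i
    proof -
      have "span {v i} = span {v i0}" using False v by (simp add: span_eq_iff_orthogonal)
      then have "v i \<in> span {v i0}" using span_base[of "v i" "{v i}"] by simp
      then show ?thesis using span_mono[of "{v i0}" ?B] by auto
    qed
    ultimately show ?thesis by blast
  qed
  then obtain B p W where W: "codim1_subspace W" "hyp_space \<inter> W \<noteq> {}" "B \<subseteq> W"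
    and rv: "range v \<subseteq> span B"
    by (metis hyperplane_through_vectors)
  have "span B \<subseteq> W" using W by (simp add: span_minimal codim1_subspace_def)
  then have "span {v i} \<subseteq> W" for i
    using W(1) rv by (intro span_minimal) (auto simp: codim1_subspace_def)
  moreover have "span {v i} \<in> ideal_boundary" for i
    using v[of i] future_lightlike_nonzero[OF v, of i]
    unfolding ideal_boundary_def future_lightlike_def by blast
  ultimately show "\<exists>P. hyperplane P \<and> (\<forall>i. span {v i} \<in> hyperplane_ideal_boundary P)"
    using W by (intro exI[of _ "hyp_space \<inter> W"])
      (auto simp: hyperplane_def hyperplane_ideal_boundary_def)
qed

section \<open>Degenerate Gram matrices\<close>

text \<open>
  Let \<open>f x\<close> be the linear combination of the \<open>v i\<close> with coefficients \<open>x\<close>. The kernel of the Gram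
  matrix consists of the \<open>x\<close> for which \<open>f x\<close> is orthogonal to all \<open>v i\<close>. For a nonzero such \<open>x\<close>,
  either \<open>f x\<close> is nonzero and the \<open>v i\<close> lie in its orthogonal hyperplane, or \<open>f x = 0\<close> is a linear
  dependence. Conversely, if the \<open>v i\<close> do not span, then \<open>f\<close> is not injective, by dimension.
\<close>

lemma det_lorentz_gram_eq_0_iff:
  fixes v :: "'m::finite \<Rightarrow> 'n::finite lorentz"
  assumes card: "CARD('m) = DIM('n lorentz)"
  shows "det (\<chi> i j. - lorentz_inner (v i) (v j)) = 0 \<longleftrightarrow> dim (range v) < DIM('n lorentz)"
    (is "det ?A = 0 \<longleftrightarrow> _")
proof -
  define f where "f = (\<lambda>x::real^'m. \<Sum>j\<in>UNIV. x $ j *\<^sub>R v j)"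
  have lin: "linear f"
    unfolding f_def by (intro linearI) (simp_all add: algebra_simps sum.distrib scaleR_sum_right)
  have Af: "(?A *v x) $ i = - lorentz_inner (v i) (f x)" for x i
    by (simp add: matrix_vector_mult_def f_def lorentz_inner_sum_right sum_negf mult.commute)
  have det0: "det ?A = 0 \<longleftrightarrow> (\<exists>x. x \<noteq> 0 \<and> ?A *v x = 0)"
    using invertible_det_nz[of ?A] invertible_left_inverse[of ?A] matrix_left_invertible_ker[of ?A]
    by blast
  show ?thesis
  proof
    assume "det ?A = 0"
    then obtain x where x: "x \<noteq> 0" "?A *v x = 0" using det0 by blast
    have orth: "lorentz_inner (v i) (f x) = 0" for i
      using Af[of x i] x(2) by simp
    show "dim (range v) < DIM('n lorentz)"
    proof (cases "f x = 0")
      case False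
      have "range v \<subseteq> {y. inner (time_reflect (f x)) y = 0}"
        using orth by (auto simp: lorentz_inner_commute[of _ "f x"] simp flip: lorentz_inner_eq_inner)
      then have "dim (range v) \<le> dim {y. inner (time_reflect (f x)) y = 0}" by (rule dim_subset)
      also have "\<dots> < DIM('n lorentz)" using False by (subst dim_hyperplane) simp_all
      finally show ?thesis .
    next
      case True
      obtain k where k: "x $ k \<noteq> 0" using x(1) by (auto simp: vec_eq_iff)
      have "x $ k *\<^sub>R v k = - (\<Sum>j\<in>UNIV - {k}. x $ j *\<^sub>R v j)"
        using True unfolding f_def by (subst (asm) sum.remove[of _ k]) (simp_all add: eq_neg_iff_add_eq_0)
      moreover have "\<dots> \<in> span (v ` (UNIV - {k}))"
        by (intro span_neg span_sum span_scale span_base) auto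
      ultimately have vk: "v k \<in> span (v ` (UNIV - {k}))"
        using k in_subspace_scale_iff[OF subspace_span] by metis
      have "range v \<subseteq> span (v ` (UNIV - {k}))"
        using vk by (auto intro: span_base) (metis Diff_iff UNIV_I imageI singletonD span_base)
      then have "dim (range v) \<le> card (v ` (UNIV - {k}))"
        by (intro dim_le_card) auto
      also have "\<dots> \<le> card (UNIV - {k})" by (rule card_image_le) simp
      also have "\<dots> < CARD('m)" by (rule psubset_card_mono) auto
      finally show ?thesis using card by simp
    qed
  next
    assume dim: "dim (range v) < DIM('n lorentz)"
    have "range f \<subseteq> span (range v)"
      unfolding f_def by (intro image_subsetI span_sum span_scale span_base rangeI)
    then have "dim (range f) \<le> dim (range v)"
      by (metis dim_span dim_subset)
    then have "dim (range f) < dim (UNIV :: (real^'m) set)" using dim card by simp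
    then have "\<not> inj f" using dim_image_eq[OF lin, of UNIV] by auto
    then obtain x where "x \<noteq> 0" "f x = 0"
      using lin linear_injective_0 by blast
    then have "x \<noteq> 0 \<and> ?A *v x = 0" using Af[of x] by (simp add: vec_eq_iff)
    then show "det ?A = 0" using det0 by blast
  qed
qed

theorem theoremA:
  fixes S :: "'m::finite \<Rightarrow> 'n::finite lorentz set"
    and A :: "real^'m^'m"
  assumes "CARD('n) \<ge> 2"
    and "CARD('m) = CARD('n) + 1"
    and "\<And>i. horosphere (S i)"
    and "A = (\<chi> i j. (lambda_length (S i) (S j))\<^sup>2)"
  shows "(\<exists>P. hyperplane P \<and> (\<forall>i. centre (S i) \<in> hyperplane_ideal_boundary P))
           \<longleftrightarrow> det A = 0"
proof -
  have "\<exists>v. future_lightlike v \<and> horosphere_of v \<noteq> {} \<and> S i = horosphere_of v" for i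
    using assms(3)[of i] future_lightlike_if_horosphere_nonempty unfolding horosphere_def by metis
  then obtain v where v: "\<And>i. future_lightlike (v i)" "\<And>i. horosphere_of (v i) \<noteq> {}"
    "\<And>i. S i = horosphere_of (v i)" by metis
  have centre: "centre (S i) = span {v i}" for i
    using v assms(1) by (simp add: centre_horosphere_of)
  have A: "A = (\<chi> i j. - lorentz_inner (v i) (v j))"
    using v assms(1,4) by (simp add: lambda_length_squared)
  have "CARD('m) = DIM('n lorentz)" using assms(2) by simp
  then show ?thesis
    unfolding centre A common_hyperplane_iff[OF assms(1) v(1)]
    by (simp only: det_lorentz_gram_eq_0_iff)
qed

end
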